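(* Let $T$ be a monoid with a fixed generating set $G$, let $M$ be a $G$-uniform $T$-graded monad on $\mathbf{Set}$, and let $\mathcal{L}=(\Theta,\mathcal{O},\Lambda)$ be a trace logic for $M$. Then the uniform-depth fragment of $\mathcal{L}$ is invariant with respect to trace equivalence in graded $M$-coalgebras: if states $x\in X$ and $y\in Y$ of graded $M$-coalgebras $(X,\gamma)$ and $(Y,\delta)$ are trace equivalent, then $[\![\phi]\!]_\gamma(x)=[\![\phi]\!]_\delta(y)$ for every $k\in T$ and every formula $\phi\in\mathcal{F}_k(\mathcal{L})$ of uniform depth $k$.
   Context: A $T$-graded monad $M$ on $\mathbf{Set}$, for a monoid $(T,\cdot,e)$, consists of endofunctors $M_t$ ($t\in T$) and natural transformations $\mu^{s,t}\colon M_sM_t\to M_{s\cdot t}$, $\eta\colon\mathrm{Id}\to M_e$ such that $\mu^{r,s\cdot t}\circ M_r\mu^{s,t}=\mu^{r\cdot s,t}\circ\mu^{r,s}M_t$ and $\mu^{t,e}\circ M_t\eta=\mathrm{id}=\mu^{e,t}\circ\eta M_t$; in particular $(M_e,\mu^{e,e},\eta)$ is a monad and $(M_tX,\mu^{e,t}_X)$ is an $M_e$-algebra. A graded $M$-coalgebra is a set $X$ with maps $\gamma_t\colon X\to M_tX$ such that $\gamma_e=\eta_X$ and $\gamma_{s\cdot t}=\mu^{s,t}_X\circ M_s\gamma_t\circ\gamma_s$. States $x\in X$, $y\in Y$ of $(X,\gamma)$, $(Y,\delta)$ are trace equivalent if $M_t(!_X)(\gamma_t(x))=M_t(!_Y)(\delta_t(y))$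 for all $t\in T$, where $!_X\colon X\to1$ and $!_Y\colon Y\to1$. $M$ is $G$-uniform if for all $g\in G$, $t\in T$ the map $\mu^{g,t}\colon M_gM_t\to M_{g\cdot t}$ is (at each set $X$) a coequalizer of $M_g\mu^{e,t},\ \mu^{g,e}M_t\colon M_gM_eM_t\to M_gM_t$ in the Eilenberg-Moore category of $(M_e,\mu^{e,e},\eta)$. A graded coalgebraic modal logic $\mathcal{L}=(\Theta,\mathcal{O},\Lambda)$ consists of a set $\Theta$ of constants, a set $\mathcal{O}$ of propositional operators $p$ with finite arities $\mathrm{ar}(p)\in\mathbb{N}$, and a set $\Lambda$ of (unary) modal operators $\lambda$ with depths $\mathsf{d}(\lambda)\in G$. The semantics is given by a set $\Omega$, elements $\hat\theta\colon1\to\Omega$, maps $[\![p]\!]\colon\Omega^{\mathrm{ar}(p)}\to\Omega$ and maps $[\![\lambda]\!]\colon M_{\mathsf{d}(\lambda)}\Omega\to\Omega$. For a graded coalgebra $(X,\gamma)$, $[\![\phi]\!]_\gamma\colon X\to\Omega$ is defined by: $[\![\theta]\!]_\gamma$ is constant with value $\hat\theta$; $[\![p(\phi_1,\dots,\phi_n)]\!]_\gamma=[\![p]\!]\circ\langle[\![\phi_1]\!]_\gamma,\dots,[\![\phi_n]\!]_\gamma\rangle$; $[\![\lambda\phi]\!]_\gamma=[\![\lambda]\!]\circ M_{\mathsf{d}(\lambda)}[\![\phi]\!]_\gamma\circ\gamma_{\mathsf{d}(\lambda)}$. $\mathcal{L}$ is a trace logic if (i) $\Omega$ carries an $M_e$-algebra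 structure $o\colon M_e\Omega\to\Omega$; (ii) each $[\![p]\!]\colon(\Omega,o)^n\to(\Omega,o)$ is an $M_e$-algebra homomorphism; (iii) for each $\lambda\in\Lambda$ of depth $t$: $[\![\lambda]\!]\circ\mu^{t,e}_\Omega=[\![\lambda]\!]\circ M_to$ and $[\![\lambda]\!]\circ\mu^{e,t}_\Omega=o\circ M_e[\![\lambda]\!]$. The sets $\mathcal{F}_k(\mathcal{L})$ ($k\in T$) of formulae of uniform depth $k$ are defined inductively: $\theta\in\mathcal{F}_e(\mathcal{L})$ for $\theta\in\Theta$; $p(\phi_1,\dots,\phi_n)\in\mathcal{F}_k(\mathcal{L})$ if $p\in\mathcal{O}$, $n=\mathrm{ar}(p)$ and all $\phi_i\in\mathcal{F}_k(\mathcal{L})$; $\lambda\phi\in\mathcal{F}_k(\mathcal{L})$ if $\phi\in\mathcal{F}_l(\mathcal{L})$ with $\mathsf{d}(\lambda)\cdot l=k$. The uniform-depth fragment is $\bigcup_{k\in T}\mathcal{F}_k(\mathcal{L})$. *)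

theory Defs
  imports Main "HOL-Library.FuncSet"
begin

section \<open>The category of sets\<close>

text \<open>
  HOL cannot quantify over functors acting on all types, so the category \<open>Set\<close> is given
  relative to a universe: a family of subsets of a type \<open>'u\<close>, called small, together with a
  pairing function for finite tuples that provides the terminal object and finite powers.
  The small sets and all functions between them form the category. Taking for \<open>'u\<close> the elements
  of a model of set theory, and for the small sets the extensions of its elements, gives \<open>Set\<close>.
  Functions \<open>A \<rightarrow> B\<close> are the members of \<open>A \<rightarrow>\<^sub>E B\<close>, so that equality of morphisms is equality
  in HOL; composition is \<^const>\<open>compose\<close>.
\<close>

record 'u universe =
  small :: "'u set set"
  tup :: "'u list \<Rightarrow> 'u"

definition pow :: "('u, 'z) universe_scheme \<Rightarrow> nat \<Rightarrow> 'u set \<Rightarrow> 'u set" where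
  "pow S n A = tup S ` {xs. length xs = n \<and> set xs \<subseteq> A}"

definition proj :: "('u, 'z) universe_scheme \<Rightarrow> nat \<Rightarrow> 'u set \<Rightarrow> nat \<Rightarrow> 'u \<Rightarrow> 'u" where
  "proj S n A i = (\<lambda>z \<in> pow S n A. inv (tup S) z ! i)"

definition one :: "('u, 'z) universe_scheme \<Rightarrow> 'u set" where
  "one S = {tup S []}"

definition bang :: "('u, 'z) universe_scheme \<Rightarrow> 'u set \<Rightarrow> 'u \<Rightarrow> 'u" where
  "bang S A = (\<lambda>x \<in> A. tup S [])"

definition ident :: "'u set \<Rightarrow> 'u \<Rightarrow> 'u" where
  "ident A = (\<lambda>x \<in> A. x)"

definition set_universe :: "('u, 'z) universe_scheme \<Rightarrow> bool" where
  "set_universe S \<longleftrightarrow>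
     inj (tup S) \<and> one S \<in> small S \<and> (\<forall>A \<in> small S. \<forall>n. pow S n A \<in> small S)"

text \<open>
  A functor acts on a morphism \<open>f : A \<rightarrow> B\<close> through \<open>Fm A B f\<close>: neither the domain nor the
  codomain can be recovered from the HOL function \<open>f\<close>.
\<close>

definition endofunctor ::
  "('u, 'z) universe_scheme \<Rightarrow> ('u set \<Rightarrow> 'u set) \<Rightarrow> ('u set \<Rightarrow> 'u set \<Rightarrow> ('u \<Rightarrow> 'u) \<Rightarrow> 'u \<Rightarrow> 'u) \<Rightarrow> bool"
where
  "endofunctor S F Fm \<longleftrightarrow>
     (\<forall>A \<in> small S. F A \<in> small S) \<and>
     (\<forall>A \<in> small S. \<forall>B \<in> small S. \<forall>f \<in> A \<rightarrow>\<^sub>E B. Fm A B f \<in> F A \<rightarrow>\<^sub>E F B) \<and>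
     (\<forall>A \<in> small S. Fm A A (ident A) = ident (F A)) \<and>
     (\<forall>A \<in> small S. \<forall>B \<in> small S. \<forall>C \<in> small S. \<forall>f \<in> A \<rightarrow>\<^sub>E B. \<forall>g \<in> B \<rightarrow>\<^sub>E C.
        Fm A C (compose A g f) = compose (F A) (Fm B C g) (Fm A B f))"

definition nat_trans ::
  "('u, 'z) universe_scheme \<Rightarrow>
   ('u set \<Rightarrow> 'u set) \<Rightarrow> ('u set \<Rightarrow> 'u set \<Rightarrow> ('u \<Rightarrow> 'u) \<Rightarrow> 'u \<Rightarrow> 'u) \<Rightarrow>
   ('u set \<Rightarrow> 'u set) \<Rightarrow> ('u set \<Rightarrow> 'u set \<Rightarrow> ('u \<Rightarrow> 'u) \<Rightarrow> 'u \<Rightarrow> 'u) \<Rightarrow>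
   ('u set \<Rightarrow> 'u \<Rightarrow> 'u) \<Rightarrow> bool"
where
  "nat_trans S F Fm H Hm \<tau> \<longleftrightarrow>
     (\<forall>A \<in> small S. \<tau> A \<in> F A \<rightarrow>\<^sub>E H A) \<and>
     (\<forall>A \<in> small S. \<forall>B \<in> small S. \<forall>f \<in> A \<rightarrow>\<^sub>E B.
        compose (F A) (\<tau> B) (Fm A B f) = compose (F A) (Hm A B f) (\<tau> A))"


section \<open>Graded monads\<close>

definition generates :: "'t::monoid_mult set \<Rightarrow> bool" where
  "generates G \<longleftrightarrow> (\<forall>t. \<exists>gs. set gs \<subseteq> G \<and> prod_list gs = t)"

record ('t, 'u) gmonad =
  Ob :: "'t \<Rightarrow> 'u set \<Rightarrow> 'u set"
  Ar :: "'t \<Rightarrow> 'u set \<Rightarrow> 'u set \<Rightarrow> ('u \<Rightarrow> 'u) \<Rightarrow> 'u \<Rightarrow> 'u"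
  mult :: "'t \<Rightarrow> 't \<Rightarrow> 'u set \<Rightarrow> 'u \<Rightarrow> 'u"
  unit :: "'u set \<Rightarrow> 'u \<Rightarrow> 'u"

definition graded_monad ::
  "('u, 'z) universe_scheme \<Rightarrow> ('t::monoid_mult, 'u, 'y) gmonad_scheme \<Rightarrow> bool"
where
  "graded_monad S M \<longleftrightarrow>
     (\<forall>t. endofunctor S (Ob M t) (Ar M t)) \<and>
     (\<forall>s t. nat_trans S
        (\<lambda>A. Ob M s (Ob M t A)) (\<lambda>A B f. Ar M s (Ob M t A) (Ob M t B) (Ar M t A B f))
        (Ob M (s * t)) (Ar M (s * t)) (mult M s t)) \<and>
     nat_trans S (\<lambda>A. A) (\<lambda>A B f. f) (Ob M 1) (Ar M 1) (unit M) \<and>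
     (\<forall>A \<in> small S. \<forall>r s t.
        compose (Ob M r (Ob M s (Ob M t A)))
          (mult M r (s * t) A) (Ar M r (Ob M s (Ob M t A)) (Ob M (s * t) A) (mult M s t A)) =
        compose (Ob M r (Ob M s (Ob M t A)))
          (mult M (r * s) t A) (mult M r s (Ob M t A))) \<and>
     (\<forall>A \<in> small S. \<forall>t.
        compose (Ob M t A) (mult M t 1 A) (Ar M t A (Ob M 1 A) (unit M A)) = ident (Ob M t A) \<and>
        compose (Ob M t A) (mult M 1 t A) (unit M (Ob M t A)) = ident (Ob M t A))"


section \<open>The Eilenberg--Moore category of the degree-one part\<close>

definition em_algebra ::
  "('u, 'z) universe_scheme \<Rightarrow> ('t::monoid_mult, 'u, 'y) gmonad_scheme \<Rightarrow>
   'u set \<Rightarrow> ('u \<Rightarrow> 'u) \<Rightarrow> bool"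
where
  "em_algebra S M A a \<longleftrightarrow>
     A \<in> small S \<and> a \<in> Ob M 1 A \<rightarrow>\<^sub>E A \<and>
     compose A a (unit M A) = ident A \<and>
     compose (Ob M 1 (Ob M 1 A)) a (mult M 1 1 A) =
       compose (Ob M 1 (Ob M 1 A)) a (Ar M 1 (Ob M 1 A) A a)"

definition em_hom ::
  "('t::monoid_mult, 'u, 'y) gmonad_scheme \<Rightarrow>
   'u set \<Rightarrow> ('u \<Rightarrow> 'u) \<Rightarrow> 'u set \<Rightarrow> ('u \<Rightarrow> 'u) \<Rightarrow> ('u \<Rightarrow> 'u) \<Rightarrow> bool"
where
  "em_hom M A a B b h \<longleftrightarrow>
     h \<in> A \<rightarrow>\<^sub>E B \<and> compose (Ob M 1 A) h a = compose (Ob M 1 A) b (Ar M 1 A B h)"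

text \<open>\<open>em_coequalizer S M A a B b f g C c q\<close>: the morphism \<open>q : (B, b) \<rightarrow> (C, c)\<close> is a coequalizer
  of the parallel pair \<open>f, g : (A, a) \<rightarrow> (B, b)\<close>.\<close>

definition em_coequalizer ::
  "('u, 'z) universe_scheme \<Rightarrow> ('t::monoid_mult, 'u, 'y) gmonad_scheme \<Rightarrow>
   'u set \<Rightarrow> ('u \<Rightarrow> 'u) \<Rightarrow> 'u set \<Rightarrow> ('u \<Rightarrow> 'u) \<Rightarrow> ('u \<Rightarrow> 'u) \<Rightarrow> ('u \<Rightarrow> 'u) \<Rightarrow>
   'u set \<Rightarrow> ('u \<Rightarrow> 'u) \<Rightarrow> ('u \<Rightarrow> 'u) \<Rightarrow> bool"
where
  "em_coequalizer S M A a B b f g C c q \<longleftrightarrow>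
     em_algebra S M A a \<and> em_algebra S M B b \<and> em_algebra S M C c \<and>
     em_hom M A a B b f \<and> em_hom M A a B b g \<and> em_hom M B b C c q \<and>
     compose A q f = compose A q g \<and>
     (\<forall>D d h. em_algebra S M D d \<longrightarrow> em_hom M B b D d h \<longrightarrow> compose A h f = compose A h g \<longrightarrow>
        (\<exists>!k. em_hom M C c D d k \<and> compose B k q = h))"

definition uniform ::
  "('u, 'z) universe_scheme \<Rightarrow> ('t::monoid_mult, 'u, 'y) gmonad_scheme \<Rightarrow> 't set \<Rightarrow> bool"
where
  "uniform S M G \<longleftrightarrow>
     (\<forall>g \<in> G. \<forall>t. \<forall>A \<in> small S.
        em_coequalizer S M
          (Ob M g (Ob M 1 (Ob M t A))) (mult M 1 g (Ob M 1 (Ob M t A)))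
          (Ob M g (Ob M t A)) (mult M 1 g (Ob M t A))
          (Ar M g (Ob M 1 (Ob M t A)) (Ob M t A) (mult M 1 t A))
          (mult M g 1 (Ob M t A))
          (Ob M (g * t) A) (mult M 1 (g * t) A)
          (mult M g t A))"

text \<open>The structure map of the \<open>n\<close>-fold power of the algebra \<open>(A, a)\<close>.\<close>

definition pow_algebra ::
  "('u, 'z) universe_scheme \<Rightarrow> ('t::monoid_mult, 'u, 'y) gmonad_scheme \<Rightarrow> nat \<Rightarrow>
   'u set \<Rightarrow> ('u \<Rightarrow> 'u) \<Rightarrow> 'u \<Rightarrow> 'u"
where
  "pow_algebra S M n A a =
     (\<lambda>z \<in> Ob M 1 (pow S n A).
        tup S (map (\<lambda>i. a (Ar M 1 (pow S n A) A (proj S n A i) z)) [0..<n]))"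


section \<open>Graded coalgebras and trace equivalence\<close>

definition graded_coalgebra ::
  "('u, 'z) universe_scheme \<Rightarrow> ('t::monoid_mult, 'u, 'y) gmonad_scheme \<Rightarrow>
   'u set \<Rightarrow> ('t \<Rightarrow> 'u \<Rightarrow> 'u) \<Rightarrow> bool"
where
  "graded_coalgebra S M X \<gamma> \<longleftrightarrow>
     X \<in> small S \<and> (\<forall>t. \<gamma> t \<in> X \<rightarrow>\<^sub>E Ob M t X) \<and>
     \<gamma> 1 = unit M X \<and>
     (\<forall>s t. \<gamma> (s * t) =
        compose X (mult M s t X) (compose X (Ar M s X (Ob M t X) (\<gamma> t)) (\<gamma> s)))"

definition trace_equivalent ::
  "('u, 'z) universe_scheme \<Rightarrow> ('t::monoid_mult, 'u, 'y) gmonad_scheme \<Rightarrow>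
   'u set \<Rightarrow> ('t \<Rightarrow> 'u \<Rightarrow> 'u) \<Rightarrow> 'u \<Rightarrow> 'u set \<Rightarrow> ('t \<Rightarrow> 'u \<Rightarrow> 'u) \<Rightarrow> 'u \<Rightarrow> bool"
where
  "trace_equivalent S M X \<gamma> x Y \<delta> y \<longleftrightarrow>
     (\<forall>t. Ar M t X (one S) (bang S X) (\<gamma> t x) = Ar M t Y (one S) (bang S Y) (\<delta> t y))"


section \<open>Graded modal logics\<close>

text \<open>Constants and operators are sets inside types, since any of these sets may be empty.\<close>

record ('c, 'p, 'l, 't) logic =
  Consts :: "'c set"
  Ops :: "'p set"
  Mods :: "'l set"
  ar :: "'p \<Rightarrow> nat"
  depth :: "'l \<Rightarrow> 't"

definition graded_logic :: "'t set \<Rightarrow> ('c, 'p, 'l, 't, 'y) logic_scheme \<Rightarrow> bool" where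
  "graded_logic G L \<longleftrightarrow> (\<forall>l \<in> Mods L. depth L l \<in> G)"

record ('c, 'p, 'l, 'u) interp =
  Truth :: "'u set"
  cval :: "'c \<Rightarrow> 'u"
  oval :: "'p \<Rightarrow> 'u \<Rightarrow> 'u"
  mval :: "'l \<Rightarrow> 'u \<Rightarrow> 'u"

definition interpretation_of ::
  "('u, 'z) universe_scheme \<Rightarrow> ('t::monoid_mult, 'u, 'y) gmonad_scheme \<Rightarrow>
   ('c, 'p, 'l, 't, 'x) logic_scheme \<Rightarrow> ('c, 'p, 'l, 'u, 'w) interp_scheme \<Rightarrow> bool"
where
  "interpretation_of S M L I \<longleftrightarrow>
     Truth I \<in> small S \<and>
     (\<forall>c \<in> Consts L. cval I c \<in> Truth I) \<and>
     (\<forall>p \<in> Ops L. oval I p \<in> pow S (ar L p) (Truth I) \<rightarrow>\<^sub>E Truth I) \<and>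
     (\<forall>l \<in> Mods L. mval I l \<in> Ob M (depth L l) (Truth I) \<rightarrow>\<^sub>E Truth I)"

definition trace_logic ::
  "('u, 'z) universe_scheme \<Rightarrow> ('t::monoid_mult, 'u, 'y) gmonad_scheme \<Rightarrow>
   ('c, 'p, 'l, 't, 'x) logic_scheme \<Rightarrow> ('c, 'p, 'l, 'u, 'w) interp_scheme \<Rightarrow> ('u \<Rightarrow> 'u) \<Rightarrow> bool"
where
  "trace_logic S M L I a \<longleftrightarrow>
     em_algebra S M (Truth I) a \<and>
     (\<forall>p \<in> Ops L.
        em_hom M (pow S (ar L p) (Truth I)) (pow_algebra S M (ar L p) (Truth I) a)
          (Truth I) a (oval I p)) \<and>
     (\<forall>l \<in> Mods L.
        compose (Ob M (depth L l) (Ob M 1 (Truth I))) (mval I l) (mult M (depth L l) 1 (Truth I)) =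
        compose (Ob M (depth L l) (Ob M 1 (Truth I))) (mval I l)
          (Ar M (depth L l) (Ob M 1 (Truth I)) (Truth I) a) \<and>
        compose (Ob M 1 (Ob M (depth L l) (Truth I))) (mval I l) (mult M 1 (depth L l) (Truth I)) =
        compose (Ob M 1 (Ob M (depth L l) (Truth I))) a
          (Ar M 1 (Ob M (depth L l) (Truth I)) (Truth I) (mval I l)))"

datatype ('c, 'p, 'l) form =
  Cst 'c
| Opr 'p "('c, 'p, 'l) form list"
| Mod 'l "('c, 'p, 'l) form"

inductive uniform_depth ::
  "('c, 'p, 'l, 't::monoid_mult, 'x) logic_scheme \<Rightarrow> 't \<Rightarrow> ('c, 'p, 'l) form \<Rightarrow> bool"
  for L :: "('c, 'p, 'l, 't, 'x) logic_scheme"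
where
  Cst: "c \<in> Consts L \<Longrightarrow> uniform_depth L 1 (Cst c)"
| Opr: "p \<in> Ops L \<Longrightarrow> length \<phi>s = ar L p \<Longrightarrow> (\<forall>\<phi> \<in> set \<phi>s. uniform_depth L k \<phi>) \<Longrightarrow>
    uniform_depth L k (Opr p \<phi>s)"
| Mod: "l \<in> Mods L \<Longrightarrow> uniform_depth L m \<phi> \<Longrightarrow> depth L l * m = k \<Longrightarrow>
    uniform_depth L k (Mod l \<phi>)"

definition uniform_forms ::
  "('c, 'p, 'l, 't::monoid_mult, 'x) logic_scheme \<Rightarrow> 't \<Rightarrow> ('c, 'p, 'l) form set"
where
  "uniform_forms L k = {\<phi>. uniform_depth L k \<phi>}"

fun sem ::
  "('u, 'z) universe_scheme \<Rightarrow> ('t::monoid_mult, 'u, 'y) gmonad_scheme \<Rightarrow>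
   ('c, 'p, 'l, 't, 'x) logic_scheme \<Rightarrow> ('c, 'p, 'l, 'u, 'w) interp_scheme \<Rightarrow>
   'u set \<Rightarrow> ('t \<Rightarrow> 'u \<Rightarrow> 'u) \<Rightarrow> ('c, 'p, 'l) form \<Rightarrow> 'u \<Rightarrow> 'u"
where
  "sem S M L I X \<gamma> (Cst c) = (\<lambda>x \<in> X. cval I c)"
| "sem S M L I X \<gamma> (Opr p \<phi>s) =
     (\<lambda>x \<in> X. oval I p (tup S (map (\<lambda>\<phi>. sem S M L I X \<gamma> \<phi> x) \<phi>s)))"
| "sem S M L I X \<gamma> (Mod l \<phi>) =
     compose X (mval I l)
       (compose X (Ar M (depth L l) X (Truth I) (sem S M L I X \<gamma> \<phi>)) (\<gamma> (depth L l)))"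

end

theory Submission
  imports Defs
begin

text \<open>
  Every formula \<open>\<phi>\<close> of uniform depth \<open>k\<close> has a homomorphism \<open>h : M\<^sub>k 1 \<rightarrow> \<Omega>\<close> of
  \<open>M\<^sub>e\<close>-algebras, the same for all coalgebras, such that \<open>\<phi>\<close> denotes \<open>h \<circ> M\<^sub>k ! \<circ> \<gamma>\<^sub>k\<close>. For a
  constant, \<open>h\<close> is the free extension of its value; for an operator, it is the composite with the
  tuple of the homomorphisms of the arguments. If \<open>h\<close> belongs to \<open>\<phi>\<close> and \<open>\<lambda>\<close> has depth \<open>g\<close>, then
  \<open>\<lambda> \<circ> M\<^sub>g h\<close> is a homomorphism that coequalizes the pair in the definition of uniformity (this is
  where the two conditions on \<open>\<lambda>\<close> enter), and its factorization through the coequalizer is the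
  homomorphism of \<open>\<lambda>\<phi>\<close>. Requiring \<open>h\<close> to be a homomorphism keeps the induction going.
\<close>

section \<open>Equations between morphisms, algebras and coalgebras, read at elements\<close>

lemma compose_eqD: "compose A g f = compose A g' f' \<Longrightarrow> x \<in> A \<Longrightarrow> g (f x) = g' (f' x)"
  by (metis compose_eq)

text \<open>Outside \<open>A\<close> both composites are \<open>undefined\<close>, so pointwise
  agreement on \<open>A\<close> already gives equality as HOL functions.\<close>

lemma compose_eqI: "(\<And>x. x \<in> A \<Longrightarrow> g (f x) = g' (f' x)) \<Longrightarrow> compose A g f = compose A g' f'"
  by (auto simp: compose_def)

lemma compose_PiE: "f \<in> A \<rightarrow>\<^sub>E B \<Longrightarrow> g \<in> B \<rightarrow>\<^sub>E C \<Longrightarrow> compose A g f \<in> A \<rightarrow>\<^sub>E C"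
  by (auto simp: compose_def)

lemma bang_PiE: "bang S A \<in> A \<rightarrow>\<^sub>E one S"
  by (auto simp: bang_def one_def)

lemma em_homD:
  assumes "em_hom M A a B b h"
  shows "h \<in> A \<rightarrow>\<^sub>E B" "z \<in> Ob M 1 A \<Longrightarrow> h (a z) = b (Ar M 1 A B h z)"
proof -
  show "h \<in> A \<rightarrow>\<^sub>E B" using assms by (simp add: em_hom_def)
  have "compose (Ob M 1 A) h a = compose (Ob M 1 A) b (Ar M 1 A B h)"
    using assms by (simp add: em_hom_def)
  then show "z \<in> Ob M 1 A \<Longrightarrow> h (a z) = b (Ar M 1 A B h z)" by (rule compose_eqD)
qed

lemma em_algebraD:
  assumes "em_algebra S M A a"
  shows "A \<in> small S" "a \<in> Ob M 1 A \<rightarrow>\<^sub>E A" "z \<in> A \<Longrightarrow> a (unit M A z) = z"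
    "w \<in> Ob M 1 (Ob M 1 A) \<Longrightarrow> a (mult M 1 1 A w) = a (Ar M 1 (Ob M 1 A) A a w)"
proof -
  show "A \<in> small S" "a \<in> Ob M 1 A \<rightarrow>\<^sub>E A" using assms unfolding em_algebra_def by blast+
  have "compose A a (unit M A) = ident A" using assms unfolding em_algebra_def by blast
  then show "a (unit M A z) = z" if "z \<in> A" using that by (auto simp: compose_def ident_def dest: fun_cong[of _ _ z])
  have "compose (Ob M 1 (Ob M 1 A)) a (mult M 1 1 A) =
      compose (Ob M 1 (Ob M 1 A)) a (Ar M 1 (Ob M 1 A) A a)"
    using assms unfolding em_algebra_def by blast
  then show "w \<in> Ob M 1 (Ob M 1 A) \<Longrightarrow> a (mult M 1 1 A w) = a (Ar M 1 (Ob M 1 A) A a w)"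
    by (rule compose_eqD)
qed

lemma graded_coalgebraD:
  assumes "graded_coalgebra S M X \<gamma>"
  shows "X \<in> small S" "\<gamma> t \<in> X \<rightarrow>\<^sub>E Ob M t X" "\<gamma> 1 = unit M X"
    "x \<in> X \<Longrightarrow> \<gamma> (s * t) x = mult M s t X (Ar M s X (Ob M t X) (\<gamma> t) (\<gamma> s x))"
proof -
  show "X \<in> small S" "\<gamma> t \<in> X \<rightarrow>\<^sub>E Ob M t X" "\<gamma> 1 = unit M X"
    using assms unfolding graded_coalgebra_def by blast+
  have "\<gamma> (s * t) = compose X (mult M s t X) (compose X (Ar M s X (Ob M t X) (\<gamma> t)) (\<gamma> s))"
    using assms unfolding graded_coalgebra_def by blast
  then show "\<gamma> (s * t) x = mult M s t X (Ar M s X (Ob M t X) (\<gamma> t) (\<gamma> s x))" if "x \<in> X"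
    using that by (simp add: compose_eq)
qed

section \<open>Functor, multiplication and unit laws of a graded monad\<close>

locale set_graded_monad =
  fixes S :: "('u, 'z) universe_scheme" and M :: "('t::monoid_mult, 'u, 'y) gmonad_scheme"
  assumes universe: "set_universe S" and monad: "graded_monad S M"
begin

lemma endofunctor_Ob: "endofunctor S (Ob M t) (Ar M t)"
  using monad unfolding graded_monad_def by blast

lemma small_one [simp]: "one S \<in> small S"
  using universe by (simp add: set_universe_def)

lemma small_pow [simp]: "A \<in> small S \<Longrightarrow> pow S n A \<in> small S"
  using universe by (simp add: set_universe_def)

lemma small_Ob [simp]: "A \<in> small S \<Longrightarrow> Ob M t A \<in> small S"
  using endofunctor_Ob[of t] by (simp add: endofunctor_def)

lemma Ar_PiE:
  "A \<in> small S \<Longrightarrow> B \<in> small S \<Longrightarrow> f \<in> A \<rightarrow>\<^sub>E B \<Longrightarrow> Ar M t A B f \<in> Ob M t A \<rightarrow>\<^sub>E Ob M t B"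
  using endofunctor_Ob[of t] unfolding endofunctor_def by blast

lemma Ar_compose:
  assumes "A \<in> small S" "B \<in> small S" "C \<in> small S" "f \<in> A \<rightarrow>\<^sub>E B" "g \<in> B \<rightarrow>\<^sub>E C" "z \<in> Ob M t A"
  shows "Ar M t A C (compose A g f) z = Ar M t B C g (Ar M t A B f z)"
proof -
  have "Ar M t A C (compose A g f) = compose (Ob M t A) (Ar M t B C g) (Ar M t A B f)"
    using endofunctor_Ob[of t] assms(1-5) unfolding endofunctor_def by blast
  then show ?thesis using assms(6) by (simp add: compose_eq)
qed

text \<open>Both sides are the image of one morphism \<open>A \<rightarrow> C\<close>: the two
  composites coincide as extensional functions, so functoriality applies to each.\<close>

lemma Ar_square:
  assumes "A \<in> small S" "B \<in> small S" "B' \<in> small S" "C \<in> small S"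
    and "f \<in> A \<rightarrow>\<^sub>E B" "g \<in> B \<rightarrow>\<^sub>E C" "f' \<in> A \<rightarrow>\<^sub>E B'" "g' \<in> B' \<rightarrow>\<^sub>E C"
    and "\<And>x. x \<in> A \<Longrightarrow> g (f x) = g' (f' x)" and "z \<in> Ob M t A"
  shows "Ar M t B C g (Ar M t A B f z) = Ar M t B' C g' (Ar M t A B' f' z)"
  using Ar_compose[of A B C f g z t] Ar_compose[of A B' C f' g' z t] assms
    compose_eqI[of A g f g' f'] by simp

lemma mult_nat_trans:
  "nat_trans S (\<lambda>A. Ob M s (Ob M t A)) (\<lambda>A B f. Ar M s (Ob M t A) (Ob M t B) (Ar M t A B f))
     (Ob M (s * t)) (Ar M (s * t)) (mult M s t)"
  using monad unfolding graded_monad_def by blast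

lemma mult_PiE: "A \<in> small S \<Longrightarrow> mult M s t A \<in> Ob M s (Ob M t A) \<rightarrow>\<^sub>E Ob M (s * t) A"
  using mult_nat_trans[of s t] by (simp add: nat_trans_def)

text \<open>Since \<open>1 * t = t\<close>, this types the multiplication as a structure map on
  \<open>Ob M t A\<close>, the form in which it enters \<open>em_hom\<close>.\<close>

lemma mult_1_PiE: "A \<in> small S \<Longrightarrow> mult M 1 t A \<in> Ob M 1 (Ob M t A) \<rightarrow>\<^sub>E Ob M t A"
  using mult_PiE[of A 1 t] by simp

lemma mult_natural:
  assumes "A \<in> small S" "B \<in> small S" "f \<in> A \<rightarrow>\<^sub>E B" "z \<in> Ob M s (Ob M t A)"
  shows "mult M s t B (Ar M s (Ob M t A) (Ob M t B) (Ar M t A B f) z) =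
    Ar M (s * t) A B f (mult M s t A z)"
proof -
  have "compose (Ob M s (Ob M t A)) (mult M s t B)
      (Ar M s (Ob M t A) (Ob M t B) (Ar M t A B f)) =
    compose (Ob M s (Ob M t A)) (Ar M (s * t) A B f) (mult M s t A)"
    using mult_nat_trans[of s t] assms(1-3) unfolding nat_trans_def by blast
  then show ?thesis using assms(4) by (rule compose_eqD)
qed

lemma unit_nat_trans: "nat_trans S (\<lambda>A. A) (\<lambda>A B f. f) (Ob M 1) (Ar M 1) (unit M)"
  using monad unfolding graded_monad_def by blast

lemma unit_natural:
  assumes "A \<in> small S" "B \<in> small S" "f \<in> A \<rightarrow>\<^sub>E B" "z \<in> A"
  shows "unit M B (f z) = Ar M 1 A B f (unit M A z)"
proof -
  have "compose A (unit M B) f = compose A (Ar M 1 A B f) (unit M A)"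
    using unit_nat_trans assms(1-3) unfolding nat_trans_def by blast
  then show ?thesis using assms(4) by (rule compose_eqD)
qed

section \<open>Composite and free homomorphisms of Eilenberg-Moore algebras\<close>

lemma em_hom_compose:
  assumes "A \<in> small S" "B \<in> small S" "C \<in> small S" "a \<in> Ob M 1 A \<rightarrow>\<^sub>E A"
    and f: "em_hom M A a B b f" and g: "em_hom M B b C c g"
  shows "em_hom M A a C c (compose A g f)"
proof -
  note [simp] = Ar_compose[OF assms(1-3) em_homD(1)[OF f] em_homD(1)[OF g]]
  have "compose A g f (a z) = c (Ar M 1 A C (compose A g f) z)" if z: "z \<in> Ob M 1 A" for z
  proof -
    \<comment> \<open>\<open>em_hom\<close> constrains only the homomorphism, not the structure
      maps; that \<open>a\<close> lands in \<open>A\<close> is a separate assumption.\<close>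
    have "a z \<in> A" "Ar M 1 A B f z \<in> Ob M 1 B"
      using z assms(4) Ar_PiE[OF assms(1,2) em_homD(1)[OF f], of 1] by auto
    then show ?thesis
      using z em_homD(2)[OF f] em_homD(2)[OF g] by (simp add: compose_eq)
  qed
  then show ?thesis
    unfolding em_hom_def using compose_PiE em_homD(1)[OF f] em_homD(1)[OF g]
    by (blast intro: compose_eqI)
qed

text \<open>The free extension of \<open>f\<close>: naturality of the multiplication moves it past
  \<open>f\<close>, and associativity of \<open>a\<close> then replaces it by the action on
  \<open>a\<close>.\<close>

lemma em_hom_free:
  assumes a: "em_algebra S M A a" and B: "B \<in> small S" and f: "f \<in> B \<rightarrow>\<^sub>E A"
  shows "em_hom M (Ob M 1 B) (mult M 1 1 B) A a (compose (Ob M 1 B) a (Ar M 1 B A f))"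
proof -
  note A = em_algebraD(1)[OF a] and aE = em_algebraD(2)[OF a]
  note fE = Ar_PiE[OF B A f, of 1]
  let ?h = "compose (Ob M 1 B) a (Ar M 1 B A f)"
  have "?h (mult M 1 1 B z) = a (Ar M 1 (Ob M 1 B) A ?h z)" if z: "z \<in> Ob M 1 (Ob M 1 B)" for z
  proof -
    have 1: "mult M 1 1 B z \<in> Ob M 1 B" using mult_1_PiE[OF B] z by auto
    have 2: "Ar M 1 (Ob M 1 B) (Ob M 1 A) (Ar M 1 B A f) z \<in> Ob M 1 (Ob M 1 A)"
      using Ar_PiE[OF _ _ fE, of 1] A B z by auto
    show ?thesis
      using 1 mult_natural[OF B A f, of z 1 1] z em_algebraD(4)[OF a 2]
        Ar_compose[OF _ _ _ fE aE, of z 1] A B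
      by (simp add: compose_eq)
  qed
  then show ?thesis
    unfolding em_hom_def using compose_PiE[OF fE aE] by (blast intro: compose_eqI)
qed

section \<open>Finite powers of algebras\<close>

lemma tup_in_pow: "length xs = n \<Longrightarrow> set xs \<subseteq> A \<Longrightarrow> tup S xs \<in> pow S n A"
  by (auto simp: pow_def)

text \<open>Injectivity of \<open>tup S\<close> makes \<open>inv (tup S)\<close> recover the encoded
  list.\<close>

lemma proj_tup: "length xs = n \<Longrightarrow> set xs \<subseteq> A \<Longrightarrow> proj S n A i (tup S xs) = xs ! i"
  using universe by (simp add: proj_def tup_in_pow set_universe_def)

lemma proj_PiE: "i < n \<Longrightarrow> proj S n A i \<in> pow S n A \<rightarrow>\<^sub>E A"
  by (auto simp: pow_def proj_tup) (auto simp: proj_def pow_def)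

text \<open>The structure map of the power is computed componentwise through the projections, and
  the projections of the tuple are the homomorphisms \<open>h i\<close>.\<close>

lemma em_hom_tuple:
  assumes C: "C \<in> small S" and A: "A \<in> small S" and c: "c \<in> Ob M 1 C \<rightarrow>\<^sub>E C"
    and h: "\<And>i. i < n \<Longrightarrow> em_hom M C c A a (h i)"
  shows "em_hom M C c (pow S n A) (pow_algebra S M n A a)
    (\<lambda>z\<in>C. tup S (map (\<lambda>i. h i z) [0..<n]))" (is "em_hom M C c ?P ?p ?t")
proof -
  have hi: "h i z \<in> A" if "i < n" "z \<in> C" for i z using em_homD(1)[OF h] that by auto
  have tE: "?t \<in> C \<rightarrow>\<^sub>E ?P" by (auto simp: hi intro!: tup_in_pow)
  \<comment> \<open>Equality as functions is required, not just on \<open>C\<close>, because the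
    functor is applied to this composite.\<close>
  have proj: "compose C (proj S n A i) ?t = h i" if i: "i < n" for i
  proof (rule extensionalityI[where A = C])
    show "h i \<in> extensional C" using em_homD(1)[OF h[OF i]] by (simp add: PiE_iff)
    show "compose C (proj S n A i) ?t z = h i z" if "z \<in> C" for z
      using i that hi
      by (subst compose_eq) (auto simp: image_subset_iff proj_tup)
  qed simp
  have "?t (c z) = ?p (Ar M 1 C ?P ?t z)" if z: "z \<in> Ob M 1 C" for z
  proof -
    have "Ar M 1 C ?P ?t z \<in> Ob M 1 ?P" using Ar_PiE[OF C _ tE, of 1] A z by auto
    moreover have "h i (c z) = a (Ar M 1 ?P A (proj S n A i) (Ar M 1 C ?P ?t z))" if i: "i < n" for i
      using em_homD(2)[OF h[OF i] z]
        Ar_compose[OF C small_pow[OF A] A tE proj_PiE[OF i] z] proj[OF i] by simp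
    moreover have "c z \<in> C" using c z by auto
    ultimately show ?thesis by (auto simp: pow_algebra_def intro!: arg_cong[where f = "tup S"])
  qed
  then show ?thesis unfolding em_hom_def using tE by (blast intro: compose_eqI)
qed

end

section \<open>Trace logics over a uniform graded monad\<close>

locale uniform_trace_logic = set_graded_monad S M
  for S :: "('u, 'z) universe_scheme" and M :: "('t::monoid_mult, 'u, 'y) gmonad_scheme" +
  fixes G :: "'t set" and L :: "('c, 'p, 'l, 't, 'x) logic_scheme"
    and I :: "('c, 'p, 'l, 'u, 'w) interp_scheme" and a :: "'u \<Rightarrow> 'u"
  assumes uniform: "uniform S M G" and logic: "graded_logic G L"
    and interp: "interpretation_of S M L I" and trace: "trace_logic S M L I a"
begin

lemma algebra: "em_algebra S M (Truth I) a"
  using trace by (simp add: trace_logic_def)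

lemma small_Truth [simp]: "Truth I \<in> small S"
  using algebra by (simp add: em_algebra_def)

lemma modality:
  assumes "l \<in> Mods L"
  shows "depth L l \<in> G" "mval I l \<in> Ob M (depth L l) (Truth I) \<rightarrow>\<^sub>E Truth I"
    and "z \<in> Ob M (depth L l) (Ob M 1 (Truth I)) \<Longrightarrow> mval I l (mult M (depth L l) 1 (Truth I) z) =
      mval I l (Ar M (depth L l) (Ob M 1 (Truth I)) (Truth I) a z)"
    and "w \<in> Ob M 1 (Ob M (depth L l) (Truth I)) \<Longrightarrow> mval I l (mult M 1 (depth L l) (Truth I) w) =
      a (Ar M 1 (Ob M (depth L l) (Truth I)) (Truth I) (mval I l) w)"
proof -
  show "depth L l \<in> G" "mval I l \<in> Ob M (depth L l) (Truth I) \<rightarrow>\<^sub>E Truth I"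
    using assms logic interp by (auto simp: graded_logic_def interpretation_of_def)
  have
    "compose (Ob M (depth L l) (Ob M 1 (Truth I))) (mval I l) (mult M (depth L l) 1 (Truth I)) =
     compose (Ob M (depth L l) (Ob M 1 (Truth I))) (mval I l)
       (Ar M (depth L l) (Ob M 1 (Truth I)) (Truth I) a)"
    "compose (Ob M 1 (Ob M (depth L l) (Truth I))) (mval I l) (mult M 1 (depth L l) (Truth I)) =
     compose (Ob M 1 (Ob M (depth L l) (Truth I))) a
       (Ar M 1 (Ob M (depth L l) (Truth I)) (Truth I) (mval I l))"
    using trace assms unfolding trace_logic_def by blast+
  note this[THEN compose_eqD]
  then show
    "z \<in> Ob M (depth L l) (Ob M 1 (Truth I)) \<Longrightarrow> mval I l (mult M (depth L l) 1 (Truth I) z) =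
      mval I l (Ar M (depth L l) (Ob M 1 (Truth I)) (Truth I) a z)"
    "w \<in> Ob M 1 (Ob M (depth L l) (Truth I)) \<Longrightarrow> mval I l (mult M 1 (depth L l) (Truth I) w) =
      a (Ar M 1 (Ob M (depth L l) (Truth I)) (Truth I) (mval I l) w)"
    by blast+
qed

section \<open>Homomorphisms representing formulae of uniform depth\<close>

definition trace_map :: "'t \<Rightarrow> ('c, 'p, 'l) form \<Rightarrow> ('u \<Rightarrow> 'u) \<Rightarrow> bool" where
  "trace_map k \<phi> h \<longleftrightarrow>
     em_hom M (Ob M k (one S)) (mult M 1 k (one S)) (Truth I) a h \<and>
     (\<forall>X \<gamma>. graded_coalgebra S M X \<gamma> \<longrightarrow>
        (\<forall>x \<in> X. sem S M L I X \<gamma> \<phi> x = h (Ar M k X (one S) (bang S X) (\<gamma> k x))))"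

lemma trace_map_PiE: "trace_map k \<phi> h \<Longrightarrow> h \<in> Ob M k (one S) \<rightarrow>\<^sub>E Truth I"
  unfolding trace_map_def by (blast dest: em_homD(1))

text \<open>At degree \<open>1\<close> the coalgebra map is the unit, so by naturality every state
  has the unit at the single point of \<open>one S\<close> as its trace; the unit law of
  \<open>a\<close> returns the value of the constant there.\<close>

lemma trace_map_Cst:
  assumes "c \<in> Consts L"
  shows "\<exists>h. trace_map 1 (Cst c) h"
proof -
  let ?f = "\<lambda>z\<in>one S. cval I c"
  let ?h = "compose (Ob M 1 (one S)) a (Ar M 1 (one S) (Truth I) ?f)"
  have c: "cval I c \<in> Truth I" using interp assms by (simp add: interpretation_of_def)
  then have f: "?f \<in> one S \<rightarrow>\<^sub>E Truth I" by auto
  have "cval I c = ?h (Ar M 1 X (one S) (bang S X) (\<gamma> 1 x))"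
    if X: "graded_coalgebra S M X \<gamma>" and x: "x \<in> X" for X \<gamma> x
  proof -
    note XS = graded_coalgebraD(1)[OF X]
    have b: "bang S X x \<in> one S" using x by (simp add: bang_def one_def)
    have "Ar M 1 X (one S) (bang S X) (\<gamma> 1 x) = unit M (one S) (bang S X x)"
      using unit_natural[OF XS small_one bang_PiE x] graded_coalgebraD(3)[OF X] by simp
    moreover have "unit M (one S) (bang S X x) \<in> Ob M 1 (one S)"
      using unit_nat_trans b by (auto simp: nat_trans_def)
    ultimately show ?thesis
      using unit_natural[OF small_one small_Truth f b] b em_algebraD(3)[OF algebra c]
      by (simp add: compose_eq)
  qed
  then show ?thesis
    unfolding trace_map_def using em_hom_free[OF algebra small_one f] by (intro exI[of _ ?h]) simp
qed

lemma trace_map_Opr: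
  assumes p: "p \<in> Ops L" and len: "length \<phi>s = ar L p"
    and ex: "\<forall>\<phi> \<in> set \<phi>s. \<exists>h. trace_map k \<phi> h"
  shows "\<exists>h. trace_map k (Opr p \<phi>s) h"
proof -
  obtain h where h: "\<And>\<phi>. \<phi> \<in> set \<phi>s \<Longrightarrow> trace_map k \<phi> (h \<phi>)" using ex by metis
  let ?A = "Ob M k (one S)" and ?n = "ar L p"
  let ?t = "\<lambda>z\<in>?A. tup S (map (\<lambda>i. h (\<phi>s ! i) z) [0..<?n])"
  have hi: "trace_map k (\<phi>s ! i) (h (\<phi>s ! i))" if "i < ?n" for i using h that len by simp
  have t: "em_hom M ?A (mult M 1 k (one S)) (pow S ?n (Truth I)) (pow_algebra S M ?n (Truth I) a) ?t"
    by (rule em_hom_tuple) (use mult_1_PiE hi in \<open>auto simp: trace_map_def\<close>)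
  have hom: "em_hom M (pow S ?n (Truth I)) (pow_algebra S M ?n (Truth I) a) (Truth I) a (oval I p)"
    using trace p by (simp add: trace_logic_def)
  have "em_hom M ?A (mult M 1 k (one S)) (Truth I) a (compose ?A (oval I p) ?t)"
    by (rule em_hom_compose[OF _ _ _ _ t hom]) (use mult_1_PiE in auto)
  moreover have "sem S M L I X \<gamma> (Opr p \<phi>s) x =
      compose ?A (oval I p) ?t (Ar M k X (one S) (bang S X) (\<gamma> k x))"
    if X: "graded_coalgebra S M X \<gamma>" and x: "x \<in> X" for X \<gamma> x
  proof -
    let ?w = "Ar M k X (one S) (bang S X) (\<gamma> k x)"
    have w: "?w \<in> ?A"
      using Ar_PiE[OF graded_coalgebraD(1)[OF X] small_one bang_PiE, of k]
        graded_coalgebraD(2)[OF X, of k] x by auto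
    \<comment> \<open>All arguments share the depth \<open>k\<close>, so their homomorphisms are
      evaluated at the same trace \<open>?w\<close>.\<close>
    have "map (\<lambda>\<phi>. sem S M L I X \<gamma> \<phi> x) \<phi>s = map (\<lambda>i. h (\<phi>s ! i) ?w) [0..<?n]"
      using hi X x by (intro nth_equalityI) (auto simp: len trace_map_def)
    then show ?thesis using w x by (simp add: compose_eq)
  qed
  ultimately show ?thesis unfolding trace_map_def by blast
qed

lemma trace_map_Mod:
  assumes l: "l \<in> Mods L" and h: "trace_map m \<phi> h"
  shows "\<exists>h'. trace_map (depth L l * m) (Mod l \<phi>) h'"
proof -
  let ?g = "depth L l" and ?O = "Truth I"
  let ?A = "Ob M m (one S)"
  let ?B = "Ob M ?g ?A" and ?q = "mult M ?g m (one S)"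
  note lE = modality(2)[OF l]
  note hE = trace_map_PiE[OF h]
  have hom: "em_hom M ?A (mult M 1 m (one S)) ?O a h" using h by (simp add: trace_map_def)
  have A: "?A \<in> small S" by simp
  note ghE = Ar_PiE[OF A small_Truth hE, of ?g]
  note h1E = Ar_PiE[OF A small_Truth hE, of 1]
  let ?f = "compose ?B (mval I l) (Ar M ?g ?A ?O h)"
  have fE: "?f \<in> ?B \<rightarrow>\<^sub>E ?O" using compose_PiE[OF ghE lE] .
  \<comment> \<open>Naturality of \<open>mult M 1 ?g\<close> at \<open>h\<close> reduces this to the
    second condition on modal operators, that \<open>mval I l\<close> commutes with the algebra
    structures.\<close>
  have f_hom: "em_hom M ?B (mult M 1 ?g ?A) ?O a ?f"
  proof -
    have "?f (mult M 1 ?g ?A z) = a (Ar M 1 ?B ?O ?f z)" if z: "z \<in> Ob M 1 ?B" for z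
    proof -
      have 1: "mult M 1 ?g ?A z \<in> ?B" using mult_1_PiE[OF A] z by auto
      have 2: "Ar M 1 ?B (Ob M ?g ?O) (Ar M ?g ?A ?O h) z \<in> Ob M 1 (Ob M ?g ?O)"
        using Ar_PiE[OF _ _ ghE, of 1] z by auto
      show ?thesis
        using 1 mult_natural[OF A small_Truth hE, of z 1 ?g] z modality(4)[OF l 2]
          Ar_compose[OF _ _ _ ghE lE, of z 1]
        by (simp add: compose_eq)
    qed
    then show ?thesis unfolding em_hom_def using fE by (blast intro: compose_eqI)
  qed
  \<comment> \<open>As \<open>h\<close> is a homomorphism, the left side is \<open>mval I l\<close>
    after the action on \<open>a\<close>; the first condition on modal operators trades that action
    for \<open>mult M ?g 1\<close>, and naturality moves \<open>h\<close> back inside.\<close>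
  have "?f (Ar M ?g (Ob M 1 ?A) ?A (mult M 1 m (one S)) z) = ?f (mult M ?g 1 ?A z)"
    if z: "z \<in> Ob M ?g (Ob M 1 ?A)" for z
  proof -
    have mE: "mult M 1 m (one S) \<in> Ob M 1 ?A \<rightarrow>\<^sub>E ?A" using mult_1_PiE by simp
    have 1: "Ar M ?g (Ob M 1 ?A) ?A (mult M 1 m (one S)) z \<in> ?B"
      using Ar_PiE[OF _ _ mE, of ?g] z by auto
    have 2: "Ar M ?g (Ob M 1 ?A) (Ob M 1 ?O) (Ar M 1 ?A ?O h) z \<in> Ob M ?g (Ob M 1 ?O)"
      using Ar_PiE[OF _ _ h1E, of ?g] z by auto
    have 3: "mult M ?g 1 ?A z \<in> ?B" using mult_PiE[OF A, of ?g 1] z by auto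
    have "Ar M ?g ?A ?O h (Ar M ?g (Ob M 1 ?A) ?A (mult M 1 m (one S)) z) =
        Ar M ?g (Ob M 1 ?O) ?O a (Ar M ?g (Ob M 1 ?A) (Ob M 1 ?O) (Ar M 1 ?A ?O h) z)"
      by (rule Ar_square[OF _ _ _ _ mE hE h1E em_algebraD(2)[OF algebra] em_homD(2)[OF hom] z])
        simp_all
    then show ?thesis
      using 1 3 modality(3)[OF l 2] mult_natural[OF A small_Truth hE, of z ?g 1] z
      by (simp add: compose_eq)
  qed
  then have coeq: "compose (Ob M ?g (Ob M 1 ?A)) ?f
      (Ar M ?g (Ob M 1 ?A) ?A (mult M 1 m (one S))) =
      compose (Ob M ?g (Ob M 1 ?A)) ?f (mult M ?g 1 ?A)" by (rule compose_eqI)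
  \<comment> \<open>The depth of a modal operator lies in \<open>G\<close> and \<open>m\<close> is
    arbitrary, so uniformity applies at the set \<open>one S\<close>.\<close>
  have "em_coequalizer S M (Ob M ?g (Ob M 1 ?A)) (mult M 1 ?g (Ob M 1 ?A)) ?B (mult M 1 ?g ?A)
      (Ar M ?g (Ob M 1 ?A) ?A (mult M 1 m (one S))) (mult M ?g 1 ?A)
      (Ob M (?g * m) (one S)) (mult M 1 (?g * m) (one S)) ?q"
    using uniform modality(1)[OF l] small_one unfolding uniform_def by blast
  then obtain h' where h': "em_hom M (Ob M (?g * m) (one S)) (mult M 1 (?g * m) (one S)) ?O a h'"
      and factor: "compose ?B h' ?q = ?f"
    using algebra f_hom coeq unfolding em_coequalizer_def by blast
  have "sem S M L I X \<gamma> (Mod l \<phi>) x = h' (Ar M (?g * m) X (one S) (bang S X) (\<gamma> (?g * m) x))"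
    if X: "graded_coalgebra S M X \<gamma>" and x: "x \<in> X" for X \<gamma> x
  proof -
    note XS = graded_coalgebraD(1)[OF X] and gE = graded_coalgebraD(2)[OF X]
    let ?b = "Ar M m X (one S) (bang S X)" and ?s = "sem S M L I X \<gamma> \<phi>"
    note bE = Ar_PiE[OF XS small_one bang_PiE, of m]
    let ?z = "\<gamma> ?g x" and ?c = "compose X ?b (\<gamma> m)"
    have z: "?z \<in> Ob M ?g X" using gE x by auto
    have cE: "?c \<in> X \<rightarrow>\<^sub>E ?A" using compose_PiE[OF gE bE] .
    have sx: "?s x = compose X h ?c x" if "x \<in> X" for x
      using h X that by (simp add: trace_map_def compose_eq)
    \<comment> \<open>The semantics enters the modal clause under the functor, so it must equal the
      composite of \<open>h\<close> and \<open>?c\<close> as a function, not only on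
      \<open>X\<close>.\<close>
    have "?s \<in> extensional X" by (cases \<phi>) auto
    then have s: "?s = compose X h ?c"
      using sx by (intro extensionalityI[of _ X]) auto
    have gz: "Ar M ?g X (Ob M m X) (\<gamma> m) ?z \<in> Ob M ?g (Ob M m X)"
      using Ar_PiE[OF XS _ gE, of m ?g] XS z by auto
    \<comment> \<open>The trace in two stages: \<open>?g\<close> steps first, then the
      depth-\<open>m\<close> trace under the functor. Multiplying with \<open>?q\<close> yields the
      trace at \<open>?g * m\<close>.\<close>
    let ?w = "Ar M ?g (Ob M m X) ?A ?b (Ar M ?g X (Ob M m X) (\<gamma> m) ?z)"
    have w: "?w \<in> ?B" using Ar_PiE[OF _ _ bE, of ?g] XS gz by auto
    have "Ar M ?g X ?O ?s ?z = Ar M ?g ?A ?O h ?w"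
      unfolding s using XS
      by (simp add: Ar_compose[OF _ _ _ cE hE z] Ar_compose[OF _ _ _ gE bE z])
    then have "sem S M L I X \<gamma> (Mod l \<phi>) x = ?f ?w"
      using x w by (simp add: compose_eq)
    also have "\<dots> = h' (?q ?w)" using factor w by (metis compose_eq)
    \<comment> \<open>Naturality of the multiplication at \<open>bang S X\<close> leaves the
      multiplied coalgebra maps, which the coalgebra law merges into one.\<close>
    also have "?q ?w = Ar M (?g * m) X (one S) (bang S X) (\<gamma> (?g * m) x)"
      using mult_natural[OF XS small_one bang_PiE gz] graded_coalgebraD(4)[OF X x] by simp
    finally show ?thesis .
  qed
  then show ?thesis unfolding trace_map_def using h' by blast
qed

lemma trace_map_exists: "uniform_depth L k \<phi> \<Longrightarrow> \<exists>h. trace_map k \<phi> h"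
proof (induction rule: uniform_depth.induct)
  case (Cst c)
  then show ?case by (rule trace_map_Cst)
next
  case (Opr p \<phi>s k)
  then show ?case by (intro trace_map_Opr) auto
next
  case (Mod l m \<phi> k)
  then show ?case using trace_map_Mod by blast
qed

end

section \<open>Invariance under trace equivalence\<close>

theorem theorem5p13:
  fixes S :: "'u universe"
    and G :: "'t::monoid_mult set"
    and M :: "('t, 'u) gmonad"
    and L :: "('c, 'p, 'l, 't) logic"
    and I :: "('c, 'p, 'l, 'u) interp"
    and a :: "'u \<Rightarrow> 'u"
    and X Y :: "'u set"
    and \<gamma> \<delta> :: "'t \<Rightarrow> 'u \<Rightarrow> 'u"
    and x y :: 'u
    and k :: 't
    and \<phi> :: "('c, 'p, 'l) form"
  assumes "set_universe S"
    and "generates G"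
    and "graded_monad S M"
    and "uniform S M G"
    and "graded_logic G L"
    and "interpretation_of S M L I"
    and "trace_logic S M L I a"
    and "graded_coalgebra S M X \<gamma>"
    and "graded_coalgebra S M Y \<delta>"
    and "x \<in> X"
    and "y \<in> Y"
    and "trace_equivalent S M X \<gamma> x Y \<delta> y"
    and "\<phi> \<in> uniform_forms L k"
  shows "sem S M L I X \<gamma> \<phi> x = sem S M L I Y \<delta> \<phi> y"
proof -
  interpret uniform_trace_logic S M G L I a
    using assms by unfold_locales
  obtain h where "trace_map k \<phi> h"
    using trace_map_exists assms(13) by (auto simp: uniform_forms_def)
  \<comment> \<open>The same \<open>h\<close> serves both coalgebras, and trace equivalence at
    degree \<open>k\<close> identifies its two arguments.\<close>
  then show ?thesis
    using assms(8-12) by (simp add: trace_map_def trace_equivalent_def)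
qed

end
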